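(* Let $f=\frac1n\sum_{i=1}^n f_i:\mathbb{R}^d\to\mathbb{R}$ with each $f_i$ continuously differentiable. Assume (i) there is $f^\star\in\mathbb{R}$ with $f(x)\ge f^\star$ for all $x$; (ii) each $f_i$ has ${\bm L}_i$-Lipschitz gradient and $f$ has ${\bm L}$-Lipschitz gradient, where ${\bm L}_i,{\bm L}\in\mathbb{S}^d_{++}$. Let $p\in(0,1]$, let $\mathcal S$ be the sketch distribution, and let ${\bm D}\in\mathbb{S}^d_{++}$ satisfy $$ {\bm D}^{-1}\succeq\left(\frac{(1-p)\,R({\bm D},\mathcal S)}{np}+1\right){\bm L},$$ where $$R({\bm D},\mathcal S):=\frac1n\sum_{i=1}^n\lambda_{\max}({\bm L}_i)\,\lambda_{\max}\!\left({\bm L}^{-1/2}{\bm L}_i{\bm L}^{-1/2}\right)\,\lambda_{\max}\!\left(\mathbb{E}[{\bm S}{\bm D}{\bm S}]-{\bm D}\right),\quad {\bm S}\sim\mathcal S.$$ Then after $K\ge1$ iterations of det-MARINA, $$\mathbb{E}\left[\|\nabla f(\tilde x^K)\|^2_{{\bm D}/\det({\bm D})^{1/d}}\right]\le\frac{2\,(f(x^0)-f^\star)}{\det({\bm D})^{1/d}\,K}.$$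
   Context: Notation: $\mathbb{S}^d_{++}$ ($\mathbb{S}^d_+$) is the set of symmetric positive definite (semidefinite) $d\times d$ matrices; for a symmetric matrix ${\bm M}$, $\|x\|_{\bm M}^2:=x^\top{\bm M}x$; $\lambda_{\max}$ denotes the largest eigenvalue. A differentiable $g:\mathbb{R}^d\to\mathbb{R}$ has ${\bm L}$-Lipschitz gradient (${\bm L}\in\mathbb{S}^d_{++}$) if $\|\nabla g(x)-\nabla g(y)\|_{{\bm L}^{-1}}\le\|x-y\|_{\bm L}$ for all $x,y$. Sketches: $\mathcal S$ is a distribution over random matrices in $\mathbb{S}^d_+$ with $\mathbb{E}[{\bm S}]={\bm I}_d$ and finite second moments; all sketches ${\bm S}_i^k$ ($i=1,\dots,n$, $k\ge0$) are i.i.d. from $\mathcal S$ and independent of everything else. Algorithm det-MARINA (input $x^0$, ${\bm D}$, $p$, $K$): set $g^0=\nabla f(x^0)$. For $k=0,\dots,K-1$: sample $c_k\sim\mathrm{Bernoulli}(p)$ independently; set $x^{k+1}=x^k-{\bm D}g^k$; for each $i$, set $g_i^{k+1}=\nabla f_i(x^{k+1})$ if $c_k=1$, and $g_i^{k+1}=g^k+{\bm S}_i^k(\nabla f_i(x^{k+1})-\nabla f_i(x^k))$ if $c_k=0$; set $g^{k+1}=\frac1n\sum_i g_i^{k+1}$. Output $\tilde x^K$ chosen uniformly at random from $\{x^0,\dots,x^{K-1}\}$. The expectation is over all randomness (coins, sketches, output index). *)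

theory Defs
  imports "HOL-Probability.Probability"
begin

type_synonym 'd mat = "real^'d^'d"

definition symm :: "'d::finite mat \<Rightarrow> bool" where
  "symm A \<longleftrightarrow> transpose A = A"

definition psd :: "'d::finite mat \<Rightarrow> bool" where
  "psd A \<longleftrightarrow> symm A \<and> (\<forall>x. 0 \<le> x \<bullet> (A *v x))"

definition pd :: "'d::finite mat \<Rightarrow> bool" where
  "pd A \<longleftrightarrow> symm A \<and> (\<forall>x. x \<noteq> 0 \<longrightarrow> 0 < x \<bullet> (A *v x))"

definition loewner_ge :: "'d::finite mat \<Rightarrow> 'd mat \<Rightarrow> bool" where
  "loewner_ge A B \<longleftrightarrow> psd (A - B)"

definition msqnorm :: "'d::finite mat \<Rightarrow> real^'d \<Rightarrow> real" where
  "msqnorm M x = x \<bullet> (M *v x)"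

definition mnorm :: "'d::finite mat \<Rightarrow> real^'d \<Rightarrow> real" where
  "mnorm M x = sqrt (msqnorm M x)"

definition lambda_max :: "'d::finite mat \<Rightarrow> real" where
  "lambda_max A = Max {l. \<exists>v. v \<noteq> 0 \<and> A *v v = l *\<^sub>R v}"

definition msqrt :: "'d::finite mat \<Rightarrow> 'd mat" where
  "msqrt A = (THE M. psd M \<and> M ** M = A)"

definition inv_sqrt :: "'d::finite mat \<Rightarrow> 'd mat" where
  "inv_sqrt A = matrix_inv (msqrt A)"

definition lipschitz_grad :: "'d::finite mat \<Rightarrow> (real^'d \<Rightarrow> real^'d) \<Rightarrow> bool" where
  "lipschitz_grad L G \<longleftrightarrow>
     (\<forall>x y. mnorm (matrix_inv L) (G x - G y) \<le> mnorm L (x - y))"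

definition sketch_distr :: "'d::finite mat measure \<Rightarrow> bool" where
  "sketch_distr S \<longleftrightarrow> prob_space S \<and> sets S = sets borel \<and>
     (AE A in S. psd A) \<and>
     integrable S (\<lambda>A. A) \<and> integrable S (\<lambda>A. (norm A)\<^sup>2) \<and>
     (\<integral>A. A \<partial>S) = mat 1"

definition R_const :: "nat \<Rightarrow> (nat \<Rightarrow> 'd::finite mat) \<Rightarrow> 'd mat \<Rightarrow> 'd mat \<Rightarrow> 'd mat measure \<Rightarrow> real" where
  "R_const n Ls L D S =
     (1 / real n) * (\<Sum>i<n. lambda_max (Ls i)
        * lambda_max (inv_sqrt L ** Ls i ** inv_sqrt L)
        * lambda_max ((\<integral>A. A ** D ** A \<partial>S) - D))"

definition avg_grad :: "nat \<Rightarrow> (nat \<Rightarrow> real^'d \<Rightarrow> real^'d) \<Rightarrow> real^'d \<Rightarrow> real^'d" where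
  "avg_grad n G x = (1 / real n) *\<^sub>R (\<Sum>i<n. G i x)"

text \<open>det-MARINA trajectory. The randomness is omega :: nat => bool * (nat => matrix):
  omega k = (c_k, S^k_.), the coin and the sketches S_i^k of iteration k.
  The state at step k is (x^k, g^k).\<close>
fun marina :: "nat \<Rightarrow> (nat \<Rightarrow> real^'d \<Rightarrow> real^'d) \<Rightarrow> 'd::finite mat \<Rightarrow> real^'d
    \<Rightarrow> (nat \<Rightarrow> bool \<times> (nat \<Rightarrow> 'd mat)) \<Rightarrow> nat \<Rightarrow> (real^'d) \<times> (real^'d)" where
  "marina n G D x0 \<omega> 0 = (x0, avg_grad n G x0)"
| "marina n G D x0 \<omega> (Suc k) =
     (let (x, g) = marina n G D x0 \<omega> k;
          x' = x - D *v g;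
          c = fst (\<omega> k);
          Sk = snd (\<omega> k);
          gi = (\<lambda>i. if c then G i x' else g + Sk i *v (G i x' - G i x))
      in (x', (1 / real n) *\<^sub>R (\<Sum>i<n. gi i)))"

definition marina_space :: "nat \<Rightarrow> real \<Rightarrow> 'd::finite mat measure
    \<Rightarrow> (nat \<Rightarrow> bool \<times> (nat \<Rightarrow> 'd mat)) measure" where
  "marina_space n p S = (\<Pi>\<^sub>M k\<in>UNIV. measure_pmf (bernoulli_pmf p) \<Otimes>\<^sub>M (\<Pi>\<^sub>M i\<in>{..<n}. S))"

end

theory Submission
  imports Defs
begin

text \<open>
  Write \<open>f = (1/n) \<Sum>\<^sub>i f\<^sub>i\<close> and consider the potential
  \<open>\<Phi>(x, v) = f x - f\<^sup>\<star> + |v - \<nabla>f x|\<^sub>D\<^sup>2 / (2p)\<close> of an iterate \<open>x\<close> with gradient estimate \<open>v\<close>.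
  Smoothness of \<open>f\<close> gives, for \<open>y = x - D v\<close>,
  \<open>f y \<le> f x - |\<nabla>f x|\<^sub>D\<^sup>2 / 2 + |v - \<nabla>f x|\<^sub>D\<^sup>2 / 2 - (|v|\<^sub>D\<^sup>2 - |D v|\<^sub>L\<^sup>2) / 2\<close>.
  Since the sketches are independent, symmetric and have mean \<open>I\<close>, the squared error of the next
  estimate has expectation
  \<open>(1 - p) (|v - \<nabla>f x|\<^sub>D\<^sup>2 + n\<^sup>-\<^sup>2 \<Sum>\<^sub>i \<Delta>\<^sub>i \<bullet> (E[S D S] - D) \<Delta>\<^sub>i)\<close> with
  \<open>\<Delta>\<^sub>i = \<nabla>f\<^sub>i y - \<nabla>f\<^sub>i x\<close>, and the sum is at most \<open>n R |y - x|\<^sub>L\<^sup>2\<close>. The condition on \<open>D\<^sup>-\<^sup>1\<close> is what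
  makes all terms in \<open>y - x\<close> cancel, so the expected potential drops by at least
  \<open>|\<nabla>f x|\<^sub>D\<^sup>2 / 2\<close> in each iteration. The telescoping runs from the first iteration for an arbitrary
  starting state, because the product measure splits off its first coordinate.
\<close>

subsection \<open>Quadratic forms\<close>

lemma symm_inner:
  assumes "symm A"
  shows "x \<bullet> (A *v y) = (A *v x) \<bullet> y"
  using assms by (metis dot_lmul_matrix symm_def vector_transpose_matrix)

lemma symmI_inner:
  assumes "\<And>x y. x \<bullet> (A *v y) = (A *v x) \<bullet> y"
  shows "symm A"
proof -
  have "x \<bullet> (transpose A *v y) = x \<bullet> (A *v y)" for x y
    by (metis assms dot_lmul_matrix transpose_matrix_vector inner_commute)
  then have "transpose A *v y = A *v y" for y
    by (metis vector_eq_ldot)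
  then show ?thesis
    by (simp add: symm_def matrix_eq)
qed

lemma symm_diff: "symm A \<Longrightarrow> symm B \<Longrightarrow> symm (A - B)"
  by (simp add: symm_def transpose_def vec_eq_iff)

lemma psd_symm: "psd A \<Longrightarrow> symm A"
  by (simp add: psd_def)

lemma pd_symm: "pd A \<Longrightarrow> symm A"
  by (simp add: pd_def)

lemma pd_imp_psd: "pd A \<Longrightarrow> psd A"
  unfolding pd_def psd_def by (metis inner_zero_left less_eq_real_def)

lemma msqnorm_nonneg: "psd A \<Longrightarrow> 0 \<le> msqnorm A x"
  by (simp add: psd_def msqnorm_def)

lemma msqnorm_scaleR_mat: "msqnorm (c *\<^sub>R A) x = c * msqnorm A x"
  by (simp add: msqnorm_def scaleR_matrix_vector_assoc [symmetric])

lemma msqnorm_scaleR: "msqnorm A (c *\<^sub>R x) = c\<^sup>2 * msqnorm A x"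
  by (simp add: msqnorm_def matrix_vector_mult_scaleR power2_eq_square)

lemma msqnorm_minus: "msqnorm A (- x) = msqnorm A x"
  using msqnorm_scaleR [of A "-1" x] by simp

lemma msqnorm_add:
  assumes "symm A"
  shows "msqnorm A (x + y) = msqnorm A x + 2 * ((A *v x) \<bullet> y) + msqnorm A y"
  using symm_inner [OF assms, of x y] symm_inner [OF assms, of y x]
  by (simp add: msqnorm_def matrix_vector_right_distrib inner_simps inner_commute)

lemma pd_invertible:
  assumes "pd A"
  shows "invertible A"
proof -
  have "x = 0" if "A *v x = 0" for x
    using assms that unfolding pd_def by (metis inner_zero_right less_irrefl)
  then show ?thesis
    by (metis invertible_left_inverse matrix_left_invertible_ker)
qed

lemma matrix_mult_matrix_inv:
  assumes "invertible A"
  shows "A ** matrix_inv A = mat 1" "matrix_inv A ** A = mat 1"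
proof -
  have "A ** matrix_inv A = mat 1 \<and> matrix_inv A ** A = mat 1"
    using assms unfolding invertible_def matrix_inv_def by (rule someI_ex)
  then show "A ** matrix_inv A = mat 1" "matrix_inv A ** A = mat 1" by auto
qed

lemma matrix_inv_mult:
  assumes "invertible A"
  shows "A *v (matrix_inv A *v x) = x" "matrix_inv A *v (A *v x) = x"
  using matrix_mult_matrix_inv [OF assms]
  by (simp_all add: matrix_vector_mul_assoc)

lemma symm_matrix_inv:
  assumes "symm A" "invertible A"
  shows "symm (matrix_inv A)"
  by (rule symmI_inner) (metis assms matrix_inv_mult symm_inner)

lemma msqnorm_matrix_inv:
  assumes "symm A" "invertible A"
  shows "msqnorm (matrix_inv A) (A *v x) = msqnorm A x"
  by (simp add: assms msqnorm_def matrix_inv_mult inner_commute)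

subsection \<open>Spectral theory of symmetric matrices\<close>

text \<open>The eigenvector is a maximiser of the quadratic form on the compact unit sphere of
  \<open>U\<close>; invariance keeps the residual \<open>A *v v - l *\<^sub>R v\<close> in
  \<open>U\<close>, so it is an admissible direction of variation. With \<open>U\<close> the whole
  space this describes \<open>lambda_max\<close>; with \<open>U\<close> an orthogonal complement it
  extends an eigenbasis.\<close>

lemma symm_eigenvector_in_invariant_subspace:
  fixes A :: "'d::finite mat"
  assumes A: "symm A" and U: "subspace U" "U \<noteq> {0}"
    and inv: "\<And>x. x \<in> U \<Longrightarrow> A *v x \<in> U"
  obtains v l where "v \<in> U" "norm v = 1" "A *v v = l *\<^sub>R v"
    "\<And>x. x \<in> U \<Longrightarrow> msqnorm A x \<le> l * (norm x)\<^sup>2"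
proof -
  have comp: "compact (U \<inter> sphere 0 1)"
    using closed_subspace [OF U(1)] by (simp add: closed_Int_compact)
  obtain u where u: "u \<in> U" "u \<noteq> 0"
    using U subspace_0 by fastforce
  then have "u /\<^sub>R norm u \<in> U \<inter> sphere 0 1"
    using U(1) by (simp add: subspace_scale)
  then have ne: "U \<inter> sphere 0 1 \<noteq> {}"
    by blast
  have cont: "continuous_on (U \<inter> sphere 0 1) (msqnorm A)"
    unfolding msqnorm_def
    by (intro continuous_intros linear_continuous_on matrix_vector_mul_bounded_linear)
  obtain v where v: "v \<in> U" "norm v = 1"
    and max: "\<And>x. x \<in> U \<Longrightarrow> norm x = 1 \<Longrightarrow> msqnorm A x \<le> msqnorm A v"
    using continuous_attains_sup [OF comp ne cont] by auto
  define l where "l = msqnorm A v"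
  have bound: "msqnorm A x \<le> l * (norm x)\<^sup>2" if "x \<in> U" for x
  proof (cases "x = 0")
    case False
    then have "msqnorm A (x /\<^sub>R norm x) \<le> l"
      unfolding l_def using that U(1) by (intro max) (simp_all add: subspace_scale)
    then show ?thesis
      using False by (simp add: msqnorm_scaleR power_inverse field_simps)
  qed (simp add: msqnorm_def)
  define u where "u = A *v v - l *\<^sub>R v"
  have uU: "u \<in> U"
    unfolding u_def using U(1) v inv by (simp add: subspace_diff subspace_scale)
  \<comment> \<open>Testing the bound at \<open>v + t u\<close>: the first-order term in \<open>t\<close> must vanish.\<close>
  have le: "2 * t * (u \<bullet> u) \<le> t\<^sup>2 * (l * (norm u)\<^sup>2 - msqnorm A u)" for t
  proof -
    have "v + t *\<^sub>R u \<in> U"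
      using U(1) v uU by (simp add: subspace_add subspace_scale)
    then have "msqnorm A (v + t *\<^sub>R u) \<le> l * (norm (v + t *\<^sub>R u))\<^sup>2"
      by (rule bound)
    moreover have "(norm (v + t *\<^sub>R u))\<^sup>2 = 1 + 2 * t * (v \<bullet> u) + t\<^sup>2 * (norm u)\<^sup>2"
      unfolding power2_norm_eq_inner using v(2) inner_commute [of u v]
      by (simp add: inner_simps power2_eq_square norm_eq_1 algebra_simps)
    moreover have "msqnorm A (v + t *\<^sub>R u) = l + 2 * t * ((A *v v) \<bullet> u) + t\<^sup>2 * msqnorm A u"
      by (simp add: msqnorm_add [OF A] msqnorm_scaleR l_def)
    moreover have "(A *v v) \<bullet> u = u \<bullet> u + l * (v \<bullet> u)"
    proof -
      have "A *v v = u + l *\<^sub>R v" by (simp add: u_def)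
      then show ?thesis by (simp only: inner_add_left inner_scaleR_left)
    qed
    ultimately have "l + 2 * t * (u \<bullet> u + l * (v \<bullet> u)) + t\<^sup>2 * msqnorm A u
        \<le> l * (1 + 2 * t * (v \<bullet> u) + t\<^sup>2 * (norm u)\<^sup>2)"
      by simp
    then show ?thesis
      by (simp add: ring_distribs mult_ac)
  qed
  have "u = 0"
  proof (rule ccontr)
    assume "u \<noteq> 0"
    then have pos: "u \<bullet> u > 0" by simp
    \<comment> \<open>Any small positive \<open>t\<close> contradicts the bound. The maximum with 1
      keeps the denominator positive, and this \<open>t\<close> makes the right side at most
      \<open>t * (u \<bullet> u)\<close>, half of the left side.\<close>
    define C where "C = max 1 (l * (norm u)\<^sup>2 - msqnorm A u)"
    define t where "t = (u \<bullet> u) / C"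
    have C: "C > 0" by (simp add: C_def)
    then have t: "t > 0" using pos by (simp add: t_def)
    have "2 * t * (u \<bullet> u) \<le> t\<^sup>2 * (l * (norm u)\<^sup>2 - msqnorm A u)"
      by (rule le)
    also have "\<dots> \<le> t\<^sup>2 * C"
      by (rule mult_left_mono) (simp_all add: C_def)
    also have "\<dots> = t * (u \<bullet> u)"
      using C by (simp add: t_def power2_eq_square)
    finally show False
      using t pos by simp
  qed
  then have "A *v v = l *\<^sub>R v"
    by (simp add: u_def)
  with that v bound show thesis by blast
qed

text \<open>One eigenvector is chosen per eigenvalue. Symmetry makes the chosen vectors orthogonal,
  hence independent, hence finite in number. This gives meaning to the \<open>Max\<close> in
  \<open>lambda_max\<close>.\<close>

lemma eigenvalues_finite:
  fixes A :: "'d::finite mat"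
  assumes A: "symm A"
  shows "finite {l. \<exists>v. v \<noteq> 0 \<and> A *v v = l *\<^sub>R v}" (is "finite ?E")
proof -
  define w where "w l = (SOME v. v \<noteq> 0 \<and> A *v v = l *\<^sub>R v)" for l
  have w: "w l \<noteq> 0 \<and> A *v w l = l *\<^sub>R w l" if "l \<in> ?E" for l
    using that unfolding w_def mem_Collect_eq by (rule someI_ex)
  have orth: "w l \<bullet> w m = 0" if "l \<in> ?E" "m \<in> ?E" "l \<noteq> m" for l m
  proof -
    have "l * (w l \<bullet> w m) = m * (w l \<bullet> w m)"
      using symm_inner [OF A, of "w l" "w m"] w [OF that(1)] w [OF that(2)] by auto
    then show ?thesis using that(3) by simp
  qed
  have inj: "inj_on w ?E"
  proof (rule inj_onI, rule ccontr)
    fix l m assume lm: "l \<in> ?E" "m \<in> ?E" "w l = w m" "l \<noteq> m"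
    then have "w l \<bullet> w l = 0" using orth [of l m] by metis
    then show False using w [OF lm(1)] by simp
  qed
  have "pairwise orthogonal (w ` ?E)"
    using orth by (auto simp: pairwise_def orthogonal_def)
  moreover have "0 \<notin> w ` ?E"
  proof
    assume "0 \<in> w ` ?E"
    then obtain l where "0 = w l" "l \<in> ?E" by (rule imageE)
    then show False using w [of l] by simp
  qed
  ultimately have "finite (w ` ?E)"
    using pairwise_orthogonal_independent independent_imp_finite by blast
  then show ?thesis
    using inj finite_imageD by blast
qed

text \<open>The maximum of the Rayleigh quotient is itself an eigenvalue and bounds every other one,
  so it is the \<open>Max\<close> of the spectrum. All later facts on \<open>lambda_max\<close> come
  from here.\<close>

lemma lambda_max_eigenvalue:
  assumes "symm A"
  obtains v where "norm v = 1" "A *v v = lambda_max A *\<^sub>R v"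
    "\<And>x. msqnorm A x \<le> lambda_max A * (norm x)\<^sup>2"
proof -
  let ?E = "{l. \<exists>v. v \<noteq> 0 \<and> A *v v = l *\<^sub>R v}"
  have "(UNIV :: (real^'a) set) \<noteq> {0}"
    by (metis UNIV_I singletonD zero_neq_one)
  then obtain v l where v: "norm v = 1" "A *v v = l *\<^sub>R v"
    and bound: "\<And>x. msqnorm A x \<le> l * (norm x)\<^sup>2"
    using symm_eigenvector_in_invariant_subspace [OF assms subspace_UNIV] by auto
  have "v \<noteq> 0"
    using v(1) by auto
  have "Max ?E = l"
  proof (rule Max_eqI)
    show "finite ?E" by (rule eigenvalues_finite [OF assms])
    show "l \<in> ?E" using v(2) \<open>v \<noteq> 0\<close> by blast
    fix m assume "m \<in> ?E"
    then obtain u where u: "u \<noteq> 0" "A *v u = m *\<^sub>R u" by blast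
    then show "m \<le> l"
      using bound [of u] by (simp add: msqnorm_def power2_norm_eq_inner)
  qed
  then show thesis
    using that v bound by (simp add: lambda_max_def)
qed

lemma msqnorm_le_lambda_max:
  "symm A \<Longrightarrow> msqnorm A x \<le> lambda_max A * (norm x)\<^sup>2"
  using lambda_max_eigenvalue by blast

lemma lambda_max_nonneg:
  assumes "psd A"
  shows "0 \<le> lambda_max A"
proof -
  obtain v where "norm v = 1" "A *v v = lambda_max A *\<^sub>R v"
    using lambda_max_eigenvalue [OF psd_symm [OF assms]] by blast
  then show ?thesis
    using msqnorm_nonneg [OF assms, of v] by (simp add: msqnorm_def norm_eq_1)
qed

lemma symm_eigenbasis:
  fixes A :: "'d::finite mat"
  assumes A: "symm A"
  obtains B l where "finite B" "pairwise orthogonal B" "\<And>b. b \<in> B \<Longrightarrow> norm b = 1"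
    "\<And>b. b \<in> B \<Longrightarrow> A *v b = l b *\<^sub>R b" "span B = UNIV"
proof -
  \<comment> \<open>The orthogonal complement of a maximal orthonormal set of eigenvectors is invariant, so if it
    were nonzero it would contain one more eigenvector.\<close>
  define P where "P B \<longleftrightarrow> pairwise orthogonal B \<and> (\<forall>b\<in>B. norm b = 1 \<and> (\<exists>l. A *v b = l *\<^sub>R b))" for B
  have bound: "finite B \<and> card B \<le> DIM(real^'d)" if "P B" for B
  proof -
    have "0 \<notin> B" using that by (auto simp: P_def)
    then have "independent B"
      using that by (intro pairwise_orthogonal_independent) (auto simp: P_def)
    then show ?thesis by (rule independent_bound)
  qed
  have "P {}" by (simp add: P_def)
  \<comment> \<open>A set of greatest cardinality exists because orthonormal sets are independent,
    so the dimension bounds their size.\<close>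
  then obtain B where B: "P B" and max: "\<And>C. P C \<Longrightarrow> card C \<le> card B"
    using ex_has_greatest_nat [of P "{}" card "Suc DIM(real^'d)"] bound
    by (metis le_imp_less_Suc)
  define U where "U = {y. \<forall>b\<in>B. orthogonal b y}"
  have subU: "subspace U"
    unfolding U_def by (rule subspace_orthogonal_to_vectors)
  have inv: "A *v x \<in> U" if "x \<in> U" for x
    unfolding U_def
  proof (intro CollectI ballI)
    fix b assume b: "b \<in> B"
    then obtain l where "A *v b = l *\<^sub>R b" using B by (auto simp: P_def)
    then show "orthogonal b (A *v x)"
      using that b by (simp add: U_def orthogonal_def symm_inner [OF A])
  qed
  have "U = {0}"
  proof (rule ccontr)
    assume "U \<noteq> {0}"
    then obtain v l where v: "v \<in> U" "norm v = 1" "A *v v = l *\<^sub>R v"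
      using symm_eigenvector_in_invariant_subspace [OF A subU \<open>U \<noteq> {0}\<close> inv] by metis
    have "v \<notin> B"
      using v(1,2) by (auto simp: U_def orthogonal_def)
    moreover have "P (insert v B)"
      using B v by (auto simp: P_def U_def pairwise_insert orthogonal_commute)
    ultimately show False
      using max [of "insert v B"] bound [OF B] by simp
  qed
  have "span B = UNIV"
  proof (intro set_eqI iffI UNIV_I)
    fix x
    obtain y z where yz: "y \<in> span B" "\<And>w. w \<in> span B \<Longrightarrow> orthogonal z w" "x = y + z"
      using orthogonal_subspace_decomp_exists by blast
    then have "z \<in> U"
      by (simp add: U_def orthogonal_commute span_base)
    with \<open>U = {0}\<close> yz show "x \<in> span B" by simp
  qed
  moreover obtain l where "\<And>b. b \<in> B \<Longrightarrow> A *v b = l b *\<^sub>R b"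
    using B unfolding P_def by metis
  ultimately show thesis
    using that [of B l] B bound [OF B] by (simp add: P_def)
qed

text \<open>The difference of the two sides is orthogonal to each basis vector, hence to the whole
  space, hence to itself.\<close>

lemma orthonormal_expansion:
  fixes B :: "'a::euclidean_space set"
  assumes "finite B" "pairwise orthogonal B" "\<And>b. b \<in> B \<Longrightarrow> norm b = 1" "span B = UNIV"
  shows "(\<Sum>b\<in>B. (b \<bullet> x) *\<^sub>R b) = x"
proof -
  have *: "c \<bullet> (\<Sum>b\<in>B. (b \<bullet> x) *\<^sub>R b) = c \<bullet> x" if "c \<in> B" for c
  proof -
    have "c \<bullet> (\<Sum>b\<in>B. (b \<bullet> x) *\<^sub>R b) = (\<Sum>b\<in>B. if b = c then c \<bullet> x else 0)"
      unfolding inner_sum_right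
      using assms(2,3) that
      by (intro sum.cong) (auto simp: pairwise_def orthogonal_def norm_eq_1)
    then show ?thesis using that assms(1) by simp
  qed
  let ?z = "(\<Sum>b\<in>B. (b \<bullet> x) *\<^sub>R b) - x"
  have "orthogonal ?z c" if "c \<in> B" for c
    using * [OF that] by (simp add: orthogonal_def inner_commute inner_simps)
  then have "orthogonal ?z ?z"
    using orthogonal_to_span [of ?z B ?z] assms(4) by auto
  then show ?thesis
    by (simp add: orthogonal_self)
qed

section \<open>Positive semidefinite square roots: existence, uniqueness and use\<close>

lemma psd_sqrt_exists:
  fixes A :: "'d::finite mat"
  assumes A: "psd A"
  obtains M where "psd M" "M ** M = A"
proof -
  obtain B l where B: "finite B" "pairwise orthogonal B" "\<And>b. b \<in> B \<Longrightarrow> norm b = 1"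
    and l: "\<And>b. b \<in> B \<Longrightarrow> A *v b = l b *\<^sub>R b" and span: "span B = UNIV"
    using symm_eigenbasis [OF psd_symm [OF A]] by metis
  have lpos: "0 \<le> l b" if "b \<in> B" for b
    using msqnorm_nonneg [OF A, of b] l [OF that] B(3) [OF that] by (simp add: msqnorm_def norm_eq_1)
  \<comment> \<open>In the eigenbasis, \<open>f\<close> scales each vector by the square root of its
    eigenvalue; positive semidefiniteness makes these roots real.\<close>
  define f where "f x = (\<Sum>b\<in>B. (sqrt (l b) * (b \<bullet> x)) *\<^sub>R b)" for x
  have "linear f"
    unfolding f_def
    by (intro linearI)
       (simp_all add: inner_simps algebra_simps sum.distrib scaleR_sum_right)
  then have f: "matrix f *v x = f x" for x
    by (simp add: matrix_works)
  have sym: "x \<bullet> f y = (\<Sum>b\<in>B. sqrt (l b) * (b \<bullet> x) * (b \<bullet> y))" for x y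
    by (simp add: f_def inner_sum_right inner_commute mult_ac)
  have "psd (matrix f)"
    unfolding psd_def f
  proof
    show "symm (matrix f)"
    proof (rule symmI_inner)
      fix x y
      show "x \<bullet> (matrix f *v y) = (matrix f *v x) \<bullet> y"
        unfolding f inner_commute [of "f x"] sym by (simp add: mult_ac)
    qed
    show "\<forall>x. 0 \<le> x \<bullet> f x"
      unfolding sym by (intro allI sum_nonneg) (simp add: lpos mult.assoc)
  qed
  moreover have "matrix f ** matrix f = A"
    unfolding matrix_eq
  proof
    fix x
    have fb: "f b = sqrt (l b) *\<^sub>R b" if "b \<in> B" for b
    proof -
      have "f b = (\<Sum>c\<in>B. if c = b then sqrt (l b) *\<^sub>R b else 0)"
        unfolding f_def
        using B(2,3) that by (intro sum.cong) (auto simp: pairwise_def orthogonal_def norm_eq_1)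
      then show ?thesis using that B(1) by simp
    qed
    have "f (f x) = (\<Sum>b\<in>B. (sqrt (l b) * (b \<bullet> x)) *\<^sub>R f b)"
      by (subst (2) f_def) (simp add: linear_sum [OF \<open>linear f\<close>] linear_scale [OF \<open>linear f\<close>])
    also have "\<dots> = (\<Sum>b\<in>B. (b \<bullet> x) *\<^sub>R (A *v b))"
    proof (rule sum.cong [OF refl])
      fix b assume b: "b \<in> B"
      have "sqrt (l b) * (sqrt (l b) * (b \<bullet> x)) = l b * (b \<bullet> x)"
        using lpos [OF b] by (simp flip: mult.assoc)
      then show "(sqrt (l b) * (b \<bullet> x)) *\<^sub>R f b = (b \<bullet> x) *\<^sub>R (A *v b)"
        using b by (simp add: fb l mult_ac)
    qed
    also have "\<dots> = A *v (\<Sum>b\<in>B. (b \<bullet> x) *\<^sub>R b)"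
      by (simp add: linear_sum [OF matrix_vector_mul_linear] matrix_vector_mult_scaleR)
    also have "\<dots> = A *v x"
      using orthonormal_expansion [OF B span] by simp
    finally show "(matrix f ** matrix f) *v x = A *v x"
      by (simp add: f flip: matrix_vector_mul_assoc)
  qed
  ultimately show thesis by (rule that)
qed

lemma lambda_max_diff_of_eq_squares:
  fixes M N :: "'d::finite mat"
  assumes M: "psd M" and N: "psd N" and eq: "M ** M = N ** N"
  shows "lambda_max (M - N) = 0"
proof -
  have sM: "symm M" and sN: "symm N" using M N by (auto intro: psd_symm)
  obtain v where v: "norm v = 1" "(M - N) *v v = lambda_max (M - N) *\<^sub>R v"
    using lambda_max_eigenvalue [OF symm_diff [OF sM sN]] by blast
  \<comment> \<open>For this eigenvector, \<open>0 = v \<bullet> (M\<^sup>2 - N\<^sup>2) v = m (v \<bullet> M v + v \<bullet> N v)\<close>.\<close>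
  define m where "m = lambda_max (M - N)"
  have Mv: "M *v v = N *v v + m *\<^sub>R v"
    using v(2) by (simp add: m_def matrix_vector_mult_diff_rdistrib algebra_simps)
  have "(M *v v) \<bullet> (M *v v) = (N *v v) \<bullet> (N *v v)"
    unfolding symm_inner [OF sM, symmetric] symm_inner [OF sN, symmetric]
    by (simp add: matrix_vector_mul_assoc eq)
  then have "m * (v \<bullet> (M *v v) + v \<bullet> (N *v v)) = 0"
    unfolding Mv by (simp add: inner_simps inner_commute algebra_simps)
  moreover have "0 \<le> v \<bullet> (M *v v)" "0 \<le> v \<bullet> (N *v v)"
    using M N by (auto simp: psd_def)
  moreover have "v \<bullet> (M *v v) = v \<bullet> (N *v v) + m"
    using v(1) unfolding Mv by (simp add: inner_simps norm_eq_1)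
  \<comment> \<open>If \<open>m\<close> were nonzero, the two nonnegative values
    \<open>v \<bullet> (M *v v)\<close> and \<open>v \<bullet> (N *v v)\<close> would sum to zero,
    so both vanish; but they differ by \<open>m\<close>.\<close>
  ultimately show ?thesis
    unfolding m_def [symmetric] by (smt (verit) mult_eq_0_iff)
qed

text \<open>Both \<open>M - N\<close> and \<open>N - M\<close> have largest eigenvalue zero, so the
  quadratic form of \<open>M - N\<close> vanishes, and polarisation kills the matrix. This
  uniqueness justifies the definite description in \<open>msqrt\<close>.\<close>

lemma psd_square_inject:
  fixes M N :: "'d::finite mat"
  assumes M: "psd M" and N: "psd N" and eq: "M ** M = N ** N"
  shows "M = N"
proof -
  have sym: "symm (M - N)" "symm (N - M)"
    using M N by (auto intro: symm_diff psd_symm)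
  have zero: "x \<bullet> ((M - N) *v x) = 0" for x
    using msqnorm_le_lambda_max [OF sym(1), of x] msqnorm_le_lambda_max [OF sym(2), of x]
      lambda_max_diff_of_eq_squares [OF M N eq] lambda_max_diff_of_eq_squares [OF N M eq [symmetric]]
    by (simp add: msqnorm_def matrix_vector_mult_diff_rdistrib inner_simps)
  have "((M - N) *v x) \<bullet> y = 0" for x y
    using msqnorm_add [OF sym(1), of x y] zero by (simp add: msqnorm_def)
  then have "(M - N) *v x = 0" for x
    using inner_eq_zero_iff by blast
  then show ?thesis
    by (simp add: matrix_eq matrix_vector_mult_diff_rdistrib)
qed

lemma msqrt:
  assumes "psd A"
  shows "psd (msqrt A)" "msqrt A ** msqrt A = A"
proof -
  obtain M where M: "psd M" "M ** M = A" using psd_sqrt_exists [OF assms] by blast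
  have "psd (msqrt A) \<and> msqrt A ** msqrt A = A"
    unfolding msqrt_def
  proof (rule theI [of _ M])
    show "psd M \<and> M ** M = A" using M by simp
    show "\<And>N. psd N \<and> N ** N = A \<Longrightarrow> N = M" using M psd_square_inject by metis
  qed
  then show "psd (msqrt A)" "msqrt A ** msqrt A = A" by auto
qed

text \<open>The root turns a weighted norm into a Euclidean one, so that Cauchy-Schwarz and the
  Rayleigh bound become applicable.\<close>

lemma msqnorm_eq_norm_msqrt:
  assumes "psd A"
  shows "msqnorm A x = (norm (msqrt A *v x))\<^sup>2"
proof -
  have "(norm (msqrt A *v x))\<^sup>2 = x \<bullet> (msqrt A *v (msqrt A *v x))"
    by (simp add: power2_norm_eq_inner symm_inner [OF psd_symm [OF msqrt(1) [OF assms]]])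
  then show ?thesis
    by (simp add: matrix_vector_mul_assoc msqrt(2) [OF assms] msqnorm_def)
qed

lemma invertible_msqrt:
  assumes "pd A"
  shows "invertible (msqrt A)"
proof -
  have "x = 0" if "msqrt A *v x = 0" for x
  proof (rule ccontr)
    assume "x \<noteq> 0"
    then have "0 < msqnorm A x" using assms by (simp add: pd_def msqnorm_def)
    then show False
      using that by (simp add: msqnorm_eq_norm_msqrt [OF pd_imp_psd [OF assms]])
  qed
  then show ?thesis
    by (metis invertible_left_inverse matrix_left_invertible_ker)
qed

text \<open>The determinant is the square of that of the invertible root. Positivity is needed for
  the normalisation by \<open>det D powr (1 / real CARD('d))\<close>.\<close>

lemma pd_det_pos:
  assumes "pd A"
  shows "0 < det A"
proof -
  have "det A = (det (msqrt A))\<^sup>2"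
    using msqrt(2) [OF pd_imp_psd [OF assms]] by (metis det_mul power2_eq_square)
  then show ?thesis
    using invertible_msqrt [OF assms] by (simp add: invertible_det_nz)
qed

section \<open>Comparison of weighted norms through largest eigenvalues and duality\<close>

lemma norm_mult_le_lambda_max:
  assumes "psd A"
  shows "(norm (A *v x))\<^sup>2 \<le> lambda_max A * msqnorm A x"
proof -
  let ?N = "msqrt A"
  \<comment> \<open>Since \<open>A = ?N ** ?N\<close>, the vector \<open>A *v x\<close> is
    \<open>?N\<close> applied to \<open>?N *v x\<close>; the Rayleigh bound is then used at
    \<open>?N *v x\<close>.\<close>
  have "(norm (A *v x))\<^sup>2 = msqnorm A (?N *v x)"
    unfolding msqnorm_eq_norm_msqrt [OF assms]
    by (simp add: matrix_vector_mul_assoc msqrt [OF assms])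
  also have "\<dots> \<le> lambda_max A * (norm (?N *v x))\<^sup>2"
    by (rule msqnorm_le_lambda_max [OF psd_symm [OF assms]])
  finally show ?thesis
    by (simp add: msqnorm_eq_norm_msqrt [OF assms])
qed

text \<open>The preceding bound at \<open>matrix_inv A *v x\<close>. It converts the dual norm of a
  Lipschitz condition to the Euclidean norm, which produces the first factor in
  \<open>R_const\<close>.\<close>

lemma norm_le_lambda_max_inv:
  assumes "pd A"
  shows "(norm x)\<^sup>2 \<le> lambda_max A * msqnorm (matrix_inv A) x"
  using norm_mult_le_lambda_max [OF pd_imp_psd [OF assms], of "matrix_inv A *v x"]
  by (simp add: msqnorm_def matrix_inv_mult pd_invertible [OF assms] inner_commute)

lemma symm_inv_sqrt:
  assumes "pd L"
  shows "symm (inv_sqrt L)"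
  unfolding inv_sqrt_def
  using assms by (intro symm_matrix_inv invertible_msqrt psd_symm msqrt pd_imp_psd)

lemma psd_congruence:
  assumes "psd A" "symm P"
  shows "psd (P ** A ** P)"
  unfolding psd_def
proof
  have eq: "x \<bullet> ((P ** A ** P) *v y) = (P *v x) \<bullet> (A *v (P *v y))" for x y
    using symm_inner [OF assms(2)] by (simp flip: matrix_vector_mul_assoc)
  show "symm (P ** A ** P)"
    by (rule symmI_inner)
      (metis eq inner_commute psd_symm [OF assms(1)] symm_inner)
  show "\<forall>x. 0 \<le> x \<bullet> ((P ** A ** P) *v x)"
    using assms(1) unfolding eq by (simp add: psd_def)
qed

text \<open>The substitution \<open>z = msqrt L *v x\<close> turns the comparison of two forms into
  a Rayleigh bound for the congruent matrix. This produces the second factor in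
  \<open>R_const\<close>.\<close>

lemma msqnorm_le_relative:
  assumes A: "psd A" and L: "pd L"
  shows "msqnorm A x \<le> lambda_max (inv_sqrt L ** A ** inv_sqrt L) * msqnorm L x"
proof -
  let ?M = "msqrt L" and ?P = "inv_sqrt L"
  have PM: "?P *v (?M *v x) = x"
    by (simp add: inv_sqrt_def matrix_inv_mult invertible_msqrt L)
  have P: "psd (?P ** A ** ?P)"
    by (intro psd_congruence A symm_inv_sqrt L)
  have "msqnorm (?P ** A ** ?P) (?M *v x) = msqnorm A x"
    unfolding msqnorm_def
    using symm_inner [OF symm_inv_sqrt [OF L], of "?M *v x"] PM
    by (simp flip: matrix_vector_mul_assoc)
  then show ?thesis
    using msqnorm_le_lambda_max [OF psd_symm [OF P], of "?M *v x"]
    by (simp add: msqnorm_eq_norm_msqrt [OF pd_imp_psd [OF L], of x])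
qed

text \<open>Writing \<open>a = L *v w\<close> and splitting \<open>L\<close> into its roots reduces
  this to Cauchy-Schwarz for the vectors \<open>msqrt L *v w\<close> and
  \<open>msqrt L *v b\<close>.\<close>

lemma inner_le_mnorm_dual:
  assumes L: "pd L"
  shows "a \<bullet> b \<le> mnorm (matrix_inv L) a * mnorm L b"
proof -
  let ?M = "msqrt L"
  have psd: "psd L" using L by (rule pd_imp_psd)
  have sM: "symm ?M" using msqrt(1) [OF psd] by (rule psd_symm)
  define w where "w = matrix_inv L *v a"
  have a: "a = L *v w"
    by (simp add: w_def matrix_inv_mult pd_invertible [OF L])
  have "a \<bullet> b = (?M *v w) \<bullet> (?M *v b)"
    unfolding symm_inner [OF sM]
    by (simp add: a matrix_vector_mul_assoc msqrt(2) [OF psd])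
  also have "\<dots> \<le> norm (?M *v w) * norm (?M *v b)"
    by (rule norm_cauchy_schwarz)
  also have "norm (?M *v w) = mnorm L w"
    by (simp add: mnorm_def msqnorm_eq_norm_msqrt [OF psd])
  also have "norm (?M *v b) = mnorm L b"
    by (simp add: mnorm_def msqnorm_eq_norm_msqrt [OF psd])
  also have "mnorm L w = mnorm (matrix_inv L) a"
    unfolding mnorm_def a
    by (simp add: msqnorm_matrix_inv pd_symm [OF L] pd_invertible [OF L])
  finally show ?thesis .
qed

lemma lipschitz_gradD:
  assumes "lipschitz_grad L g" "pd L"
  shows "msqnorm (matrix_inv L) (g x - g y) \<le> msqnorm L (x - y)"
  using assms unfolding lipschitz_grad_def mnorm_def by simp

subsection \<open>Smoothness and sketches\<close>

text \<open>Monotonicity along the segment from \<open>x\<close> to \<open>x + h\<close> takes the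
  place of integrating the gradient: \<open>\<psi>\<close> collects the terms so that its derivative
  is nonpositive by norm duality and the Lipschitz condition.\<close>

lemma smooth_upper_bound:
  fixes f :: "real^'d::finite \<Rightarrow> real"
  assumes f: "\<And>x. (f has_derivative (\<lambda>h. g x \<bullet> h)) (at x)"
    and L: "pd L" and g: "lipschitz_grad L g"
  shows "f (x + h) \<le> f x + g x \<bullet> h + msqnorm L h / 2"
proof -
  define \<psi> where "\<psi> t = f (x + t *\<^sub>R h) - t * (g x \<bullet> h) - t\<^sup>2 / 2 * msqnorm L h" for t :: real
  have "\<psi> 1 \<le> \<psi> 0"
  proof (rule DERIV_nonpos_imp_nonincreasing [of 0 1 \<psi>])
    fix t :: real assume t: "0 \<le> t" "t \<le> 1"
    let ?y = "x + t *\<^sub>R h"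
    have "((\<lambda>t. f (x + t *\<^sub>R h)) has_derivative (\<lambda>s. g ?y \<bullet> (s *\<^sub>R h))) (at t)"
      by (rule has_derivative_compose [OF _ f]) (auto intro!: derivative_eq_intros)
    then have "((\<lambda>t. f (x + t *\<^sub>R h)) has_real_derivative g ?y \<bullet> h) (at t)"
      by (simp add: has_field_derivative_def mult_commute_abs)
    then have "(\<psi> has_real_derivative (g ?y - g x) \<bullet> h - t * msqnorm L h) (at t)"
      unfolding \<psi>_def by (auto intro!: derivative_eq_intros simp: inner_simps)
    moreover have "(g ?y - g x) \<bullet> h \<le> t * msqnorm L h"
    proof -
      have "(g ?y - g x) \<bullet> h \<le> mnorm (matrix_inv L) (g ?y - g x) * mnorm L h"
        by (rule inner_le_mnorm_dual [OF L])
      also have "\<dots> \<le> mnorm L (?y - x) * mnorm L h"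
        using g msqnorm_nonneg [OF pd_imp_psd [OF L], of h]
        by (intro mult_right_mono) (auto simp only: lipschitz_grad_def mnorm_def real_sqrt_ge_zero)
      also have "\<dots> = t * msqnorm L h"
        using t msqnorm_nonneg [OF pd_imp_psd [OF L], of h]
        by (simp add: mnorm_def msqnorm_scaleR real_sqrt_mult)
      finally show ?thesis .
    qed
    then have "(g ?y - g x) \<bullet> h - t * msqnorm L h \<le> 0"
      by linarith
    ultimately show "\<exists>y. (\<psi> has_real_derivative y) (at t) \<and> y \<le> 0"
      by blast
  qed simp
  then show ?thesis
    by (simp add: \<psi>_def)
qed

section \<open>Bilinearity and measurability of matrix products\<close>

lemma bounded_bilinear_matrix_vector_mult:
  "bounded_bilinear ((*v) :: real^'n^'m \<Rightarrow> real^'n \<Rightarrow> real^'m)"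
  unfolding bilinear_conv_bounded_bilinear [symmetric] bilinear_def
  by (intro conjI allI linearI)
     (simp_all add: matrix_vector_mult_add_rdistrib matrix_vector_right_distrib
       matrix_vector_mult_scaleR flip: scaleR_matrix_vector_assoc)

lemma bounded_bilinear_matrix_matrix_mult:
  "bounded_bilinear ((**) :: real^'n^'m \<Rightarrow> real^'k^'n \<Rightarrow> real^'k^'m)"
  unfolding bilinear_conv_bounded_bilinear [symmetric] bilinear_def
  by (intro conjI allI linearI)
     (simp_all add: matrix_matrix_mult_def vec_eq_iff algebra_simps sum.distrib sum_distrib_left)

lemma borel_measurable_matrix_vector_mult [measurable (raw)]:
  fixes f :: "'a \<Rightarrow> real^'n::finite^'m::finite"
  assumes "f \<in> borel_measurable M" "g \<in> borel_measurable M"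
  shows "(\<lambda>x. f x *v g x) \<in> borel_measurable M"
  using assms
  by (rule borel_measurable_continuous_Pair)
     (intro bounded_bilinear.continuous_on [OF bounded_bilinear_matrix_vector_mult] continuous_intros)

lemma borel_measurable_matrix_matrix_mult [measurable (raw)]:
  fixes f :: "'a \<Rightarrow> real^'n::finite^'m::finite" and g :: "'a \<Rightarrow> real^'k::finite^'n"
  assumes "f \<in> borel_measurable M" "g \<in> borel_measurable M"
  shows "(\<lambda>x. f x ** g x) \<in> borel_measurable M"
  using assms
  by (rule borel_measurable_continuous_Pair)
     (intro bounded_bilinear.continuous_on [OF bounded_bilinear_matrix_matrix_mult] continuous_intros)

lemma borel_measurable_msqnorm [measurable (raw)]:
  assumes "f \<in> borel_measurable M"
  shows "(\<lambda>x. msqnorm D (f x)) \<in> borel_measurable M"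
  unfolding msqnorm_def using assms by measurable

section \<open>Second-moment calculus of a random sketch\<close>

locale sketch =
  fixes S :: "'d::finite mat measure" and D :: "'d mat"
  assumes S: "sketch_distr S" and D: "psd D"
begin

text \<open>Because sketches have mean \<open>mat 1\<close>, this is the expectation of
  \<open>(A - mat 1) ** D ** (A - mat 1)\<close>, a covariance weighted by \<open>D\<close>. Its
  largest eigenvalue is the third factor in \<open>R_const\<close>.\<close>

definition excess :: "'d mat" where
  "excess = (\<integral>A. A ** D ** A \<partial>S) - D"

lemma sets_S [measurable_cong]: "sets S = sets borel"
  using S by (simp add: sketch_distr_def)

sublocale S: prob_space S
  using S by (simp add: sketch_distr_def)

lemma integrable_sketch: "integrable S (\<lambda>A. A)"
  and integral_sketch: "(\<integral>A. A \<partial>S) = mat 1"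
  and integrable_sketch_sq: "integrable S (\<lambda>A. (norm A)\<^sup>2)"
  and AE_sketch_psd: "AE A in S. psd A"
  using S unfolding sketch_distr_def by blast+

text \<open>Submultiplicativity up to a constant \<open>C\<close> dominates the integrand by a
  multiple of the squared norm, which the finite second moment makes integrable.\<close>

lemma integrable_sandwich: "integrable S (\<lambda>A. A ** D ** A)"
proof -
  obtain C where C: "0 \<le> C" "\<And>(A :: 'd mat) (B :: 'd mat). norm (A ** B) \<le> norm A * norm B * C"
    using bounded_bilinear.nonneg_bounded [OF bounded_bilinear_matrix_matrix_mult] by blast
  have "norm (A ** D ** A) \<le> (C * C * norm D) * (norm A)\<^sup>2" for A
  proof -
    have "norm (A ** D ** A) \<le> norm (A ** D) * norm A * C" by (rule C)
    also have "\<dots> \<le> (norm A * norm D * C) * norm A * C"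
      by (intro mult_right_mono C) auto
    finally show ?thesis by (simp add: power2_eq_square mult_ac)
  qed
  then have "norm (A ** D ** A) \<le> norm ((C * C * norm D) * (norm A)\<^sup>2)" for A
    by (smt (verit) real_norm_def)
  then show ?thesis
    by (intro Bochner_Integration.integrable_bound
          [OF integrable_mult_right [OF integrable_sketch_sq, of "C * C * norm D"]] AE_I2) auto
qed

lemma inner_sandwich:
  assumes "symm A"
  shows "x \<bullet> ((A ** D ** A) *v y) = (A *v x) \<bullet> (D *v (A *v y))"
  using symm_inner [OF assms] by (simp flip: matrix_vector_mul_assoc)

lemma bounded_linear_bilinear_form: "bounded_linear (\<lambda>A :: 'd mat. x \<bullet> (A *v y))"
  by (rule bounded_linear_inner_right_comp
        [OF bounded_bilinear.bounded_linear_left [OF bounded_bilinear_matrix_vector_mult]])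

lemma excess_form: "x \<bullet> (excess *v y) = (\<integral>A. x \<bullet> ((A ** D ** A) *v y) \<partial>S) - x \<bullet> (D *v y)"
  unfolding excess_def matrix_vector_mult_diff_rdistrib inner_diff_right
    integral_bounded_linear [OF bounded_linear_bilinear_form integrable_sandwich] ..

text \<open>Sketches are symmetric only almost surely, so the two bilinear forms are compared under
  the integral sign rather than pointwise.\<close>

lemma symm_excess: "symm excess"
proof (rule symmI_inner)
  fix x y
  have "(\<integral>A. x \<bullet> ((A ** D ** A) *v y) \<partial>S) = (\<integral>A. y \<bullet> ((A ** D ** A) *v x) \<partial>S)"
  proof (rule integral_cong_AE)
    show "AE A in S. x \<bullet> ((A ** D ** A) *v y) = y \<bullet> ((A ** D ** A) *v x)"
      using AE_sketch_psd
    proof eventually_elim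
      case (elim A)
      show ?case
        unfolding inner_sandwich [OF psd_symm [OF elim]]
        by (metis D inner_commute psd_symm symm_inner)
    qed
  qed measurable
  then show "x \<bullet> (excess *v y) = (excess *v x) \<bullet> y"
    using symm_inner [OF psd_symm [OF D], of x y]
    unfolding inner_commute [of "excess *v x"] excess_form by (simp only: inner_commute)
qed

text \<open>A bias-variance decomposition: \<open>A *v u - u\<close> has mean zero, so the cross
  term with \<open>v\<close> disappears and only the covariance remains.\<close>

lemma has_bochner_integral_sketch_step:
  "has_bochner_integral S (\<lambda>A. msqnorm D (v + c *\<^sub>R (A *v u - u)))
     (msqnorm D v + c\<^sup>2 * msqnorm excess u)"
proof -
  have sD: "symm D" using D by (rule psd_symm)
  define w where "w = v - c *\<^sub>R u"
  \<comment> \<open>The expansion of the integrand around \<open>w\<close>. It is linear in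
    \<open>A\<close> and \<open>A ** D ** A\<close>, so it integrates term by term; it agrees with
    the integrand wherever \<open>A\<close> is symmetric.\<close>
  define q where "q A = msqnorm D w + (2 * c) * ((D *v w) \<bullet> (A *v u))
      + c\<^sup>2 * (u \<bullet> ((A ** D ** A) *v u))" for A :: "'d mat"
  have int1: "integrable S (\<lambda>A. (D *v w) \<bullet> (A *v u))"
    by (rule integrable_bounded_linear [OF bounded_linear_bilinear_form integrable_sketch])
  have int1_eq: "(\<integral>A. (D *v w) \<bullet> (A *v u) \<partial>S) = (D *v w) \<bullet> u"
    unfolding integral_bounded_linear [OF bounded_linear_bilinear_form integrable_sketch]
    by (simp add: integral_sketch)
  have int2: "integrable S (\<lambda>A. u \<bullet> ((A ** D ** A) *v u))"
    by (rule integrable_bounded_linear [OF bounded_linear_bilinear_form integrable_sandwich])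
  have q: "integrable S q"
    unfolding q_def using int1 int2 by simp
  have "(\<integral>A. q A \<partial>S) = msqnorm D w + (2 * c) * ((D *v w) \<bullet> u)
      + c\<^sup>2 * (u \<bullet> (excess *v u) + msqnorm D u)"
    using int1 int2
    by (simp add: q_def excess_form S.prob_space msqnorm_def int1_eq)
  \<comment> \<open>The terms without \<open>excess\<close> recombine to the form at
    \<open>w + c *\<^sub>R u\<close>, which is \<open>v\<close>.\<close>
  also have "\<dots> = msqnorm D v + c\<^sup>2 * msqnorm excess u"
    using msqnorm_add [OF sD, of w "c *\<^sub>R u"]
    by (simp add: w_def msqnorm_scaleR msqnorm_def [of excess] algebra_simps)
  finally have eq: "(\<integral>A. q A \<partial>S) = msqnorm D v + c\<^sup>2 * msqnorm excess u" .
  have AE: "AE A in S. msqnorm D (v + c *\<^sub>R (A *v u - u)) = q A"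
    using AE_sketch_psd
  proof eventually_elim
    case (elim A)
    have "v + c *\<^sub>R (A *v u - u) = w + c *\<^sub>R (A *v u)"
      by (simp add: w_def algebra_simps)
    then show ?case
      using inner_sandwich [OF psd_symm [OF elim]]
      by (simp add: msqnorm_add [OF sD] msqnorm_scaleR q_def msqnorm_def [of D "A *v u"])
  qed
  have "has_bochner_integral S q (msqnorm D v + c\<^sup>2 * msqnorm excess u)"
    using q eq by (simp add: has_bochner_integral_iff)
  then show ?thesis
    by (subst has_bochner_integral_cong_AE [OF _ _ AE]) (simp_all add: q_def)
qed

text \<open>With \<open>v = 0\<close> and \<open>c = 1\<close> the step formula exhibits the form of
  \<open>excess\<close> as an integral of nonnegative values.\<close>

lemma psd_excess: "psd excess"
  unfolding psd_def
proof (intro conjI allI symm_excess)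
  fix u
  have "0 \<le> (\<integral>A. msqnorm D (0 + 1 *\<^sub>R (A *v u - u)) \<partial>S)"
    by (intro integral_nonneg_AE AE_I2 msqnorm_nonneg D)
  then show "0 \<le> u \<bullet> (excess *v u)"
    using has_bochner_integral_integral_eq [OF has_bochner_integral_sketch_step [of 0 1 u]]
    by (simp add: msqnorm_def)
qed

lemma nn_integral_sketch_step:
  "(\<integral>\<^sup>+A. ennreal (msqnorm D (v + c *\<^sub>R (A *v u - u))) \<partial>S)
     = ennreal (msqnorm D v + c\<^sup>2 * msqnorm excess u)"
  using has_bochner_integral_sketch_step [of v c u]
  by (subst nn_integral_eq_integral)
     (auto simp: has_bochner_integral_iff msqnorm_nonneg D)

text \<open>Independence lets the sketches be integrated one at a time. The innermost integral over
  the new sketch treats the partial sum \<open>?w s\<close> as fixed and leaves its weighted norm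
  plus a constant, so variances add without cross terms.\<close>

lemma nn_integral_sketch_sum:
  assumes "finite I"
  shows "(\<integral>\<^sup>+s. ennreal (msqnorm D (v + c *\<^sub>R (\<Sum>i\<in>I. s i *v u i - u i))) \<partial>(\<Pi>\<^sub>M i\<in>I. S))
     = ennreal (msqnorm D v + c\<^sup>2 * (\<Sum>i\<in>I. msqnorm excess (u i)))"
  using assms
proof induction
  case empty
  show ?case
    by (simp add: PiM_empty)
next
  case (insert j I)
  interpret product_sigma_finite "\<lambda>_. S" ..
  interpret P: prob_space "\<Pi>\<^sub>M i\<in>I. S"
    by (rule prob_space_PiM) (rule S.prob_space_axioms)
  let ?w = "\<lambda>s. v + c *\<^sub>R (\<Sum>i\<in>I. s i *v u i - u i)"
  have "(\<integral>\<^sup>+s. ennreal (msqnorm D (v + c *\<^sub>R (\<Sum>i\<in>insert j I. s i *v u i - u i))) \<partial>(\<Pi>\<^sub>M i\<in>insert j I. S))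
      = (\<integral>\<^sup>+s. \<integral>\<^sup>+A. ennreal (msqnorm D (v + c *\<^sub>R (\<Sum>i\<in>insert j I. (s(j := A)) i *v u i - u i))) \<partial>S \<partial>(\<Pi>\<^sub>M i\<in>I. S))"
    using insert.hyps by (intro product_nn_integral_insert) measurable
  also have "\<dots> = (\<integral>\<^sup>+s. \<integral>\<^sup>+A. ennreal (msqnorm D (?w s + c *\<^sub>R (A *v u j - u j))) \<partial>S \<partial>(\<Pi>\<^sub>M i\<in>I. S))"
  proof (intro nn_integral_cong arg_cong [where f = ennreal] arg_cong [where f = "msqnorm D"])
    fix s A
    have "(\<Sum>i\<in>I. (s(j := A)) i *v u i - u i) = (\<Sum>i\<in>I. s i *v u i - u i)"
      using insert.hyps by (intro sum.cong) auto
    then show "v + c *\<^sub>R (\<Sum>i\<in>insert j I. (s(j := A)) i *v u i - u i) = ?w s + c *\<^sub>R (A *v u j - u j)"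
      using insert.hyps by (simp add: algebra_simps)
  qed
  also have "\<dots> = (\<integral>\<^sup>+s. ennreal (msqnorm D (?w s)) + ennreal (c\<^sup>2 * msqnorm excess (u j)) \<partial>(\<Pi>\<^sub>M i\<in>I. S))"
    by (simp add: nn_integral_sketch_step msqnorm_nonneg D psd_excess)
  also have "\<dots> = ennreal (msqnorm D v + c\<^sup>2 * (\<Sum>i\<in>I. msqnorm excess (u i))) + ennreal (c\<^sup>2 * msqnorm excess (u j))"
    by (subst nn_integral_add) (auto simp: insert.IH P.emeasure_space_1)
  also have "\<dots> = ennreal (msqnorm D v + c\<^sup>2 * (\<Sum>i\<in>insert j I. msqnorm excess (u i)))"
    using insert.hyps
    by (subst ennreal_plus [symmetric])
       (auto simp: msqnorm_nonneg D psd_excess sum_nonneg algebra_simps)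
  finally show ?case .
qed

end

subsection \<open>The iteration\<close>

lemma has_derivative_average:
  assumes "\<And>i. i < n \<Longrightarrow> (fs i has_derivative (\<lambda>h. G i x \<bullet> h)) (at x)"
  shows "((\<lambda>x. (1 / real n) * (\<Sum>i<n. fs i x)) has_derivative (\<lambda>h. avg_grad n G x \<bullet> h)) (at x)"
  unfolding avg_grad_def inner_scaleR_left inner_sum_left
  by (intro has_derivative_mult_right has_derivative_sum) (use assms in auto)

locale det_marina = sketch S D
  for S :: "'d::finite mat measure" and D :: "'d mat" +
  fixes fs :: "nat \<Rightarrow> real^'d \<Rightarrow> real" and G :: "nat \<Rightarrow> real^'d \<Rightarrow> real^'d"
    and n :: nat and fstar :: real and Ls :: "nat \<Rightarrow> 'd mat" and L :: "'d mat" and p :: real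
  assumes n_pos: "n \<ge> 1"
    and grad: "\<And>i x. i < n \<Longrightarrow> (fs i has_derivative (\<lambda>h. G i x \<bullet> h)) (at x)"
    and cont: "\<And>i. i < n \<Longrightarrow> continuous_on UNIV (G i)"
    and lower: "\<And>x. (1 / real n) * (\<Sum>i<n. fs i x) \<ge> fstar"
    and Ls_pd: "\<And>i. i < n \<Longrightarrow> pd (Ls i)"
    and L_pd: "pd L"
    and Li_lip: "\<And>i. i < n \<Longrightarrow> lipschitz_grad (Ls i) (G i)"
    and L_lip: "lipschitz_grad L (avg_grad n G)"
    and p: "0 < p" "p \<le> 1"
    and D_pd: "pd D"
    and D_step: "loewner_ge (matrix_inv D)
                   (((1 - p) * R_const n Ls L D S / (real n * p) + 1) *\<^sub>R L)"
begin

abbreviation f :: "real^'d \<Rightarrow> real" where "f x \<equiv> (1 / real n) * (\<Sum>i<n. fs i x)"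
abbreviation g :: "real^'d \<Rightarrow> real^'d" where "g \<equiv> avg_grad n G"
abbreviation R :: real where "R \<equiv> R_const n Ls L D S"

text \<open>The three factors arise in turn: Rayleigh bound for \<open>excess\<close>, Euclidean
  norm against the dual norm of \<open>Ls i\<close>, and, after the Lipschitz condition,
  \<open>Ls i\<close> relative to \<open>L\<close>.\<close>

lemma excess_gradient_diff:
  assumes "i < n"
  shows "msqnorm excess (G i y - G i x)
    \<le> lambda_max (Ls i) * lambda_max (inv_sqrt L ** Ls i ** inv_sqrt L) * lambda_max excess * msqnorm L (y - x)"
proof -
  let ?u = "G i y - G i x"
  let ?l = "lambda_max (Ls i)" and ?r = "lambda_max (inv_sqrt L ** Ls i ** inv_sqrt L)"
  note pd = Ls_pd [OF assms]
  have l: "0 \<le> ?l" by (intro lambda_max_nonneg pd_imp_psd pd)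
  have e: "0 \<le> lambda_max excess" by (intro lambda_max_nonneg psd_excess)
  have "(norm ?u)\<^sup>2 \<le> ?l * msqnorm (matrix_inv (Ls i)) ?u"
    by (rule norm_le_lambda_max_inv [OF pd])
  also have "\<dots> \<le> ?l * (?r * msqnorm L (y - x))"
    using lipschitz_gradD [OF Li_lip [OF assms] pd, of y x]
      msqnorm_le_relative [OF pd_imp_psd [OF pd] L_pd, of "y - x"]
    by (intro mult_left_mono l) linarith
  finally have "lambda_max excess * (norm ?u)\<^sup>2 \<le> lambda_max excess * (?l * (?r * msqnorm L (y - x)))"
    by (rule mult_left_mono [OF _ e])
  then show ?thesis
    using msqnorm_le_lambda_max [OF symm_excess, of ?u] by (simp add: mult_ac)
qed

lemma sum_excess_gradient_diff:
  "(1 / real n)\<^sup>2 * (\<Sum>i<n. msqnorm excess (G i y - G i x)) \<le> R / real n * msqnorm L (y - x)"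
proof -
  have "(\<Sum>i<n. msqnorm excess (G i y - G i x)) \<le> (\<Sum>i<n. lambda_max (Ls i)
      * lambda_max (inv_sqrt L ** Ls i ** inv_sqrt L) * lambda_max excess * msqnorm L (y - x))"
    by (intro sum_mono excess_gradient_diff) simp
  \<comment> \<open>\<open>R\<close> is an average over \<open>i\<close>, so the sum is
    \<open>n\<close> times it and the prefactor \<open>(1 / real n)\<^sup>2\<close> leaves
    \<open>R / real n\<close>.\<close>
  also have "\<dots> = real n * R * msqnorm L (y - x)"
    using n_pos by (simp add: R_const_def excess_def sum_distrib_right)
  finally have "(1 / real n)\<^sup>2 * (\<Sum>i<n. msqnorm excess (G i y - G i x))
      \<le> (1 / real n)\<^sup>2 * (real n * R * msqnorm L (y - x))"
    by (rule mult_left_mono) simp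
  then show ?thesis
    using n_pos by (simp add: power2_eq_square)
qed

lemma has_derivative_f: "(f has_derivative (\<lambda>h. g x \<bullet> h)) (at x)"
  by (rule has_derivative_average) (rule grad)

text \<open>Polarisation rewrites the linear term of the smoothness bound. The condition on
  \<open>D\<close>, tested at \<open>D *v v\<close>, gives
  \<open>(c + 1) * msqnorm L (D *v v) \<le> msqnorm D v\<close>: one unit pays for the smoothness
  term, and the surplus \<open>c\<close> is kept to pay for the sketch variance.\<close>

lemma descent:
  defines "c \<equiv> (1 - p) * R / (real n * p)"
  shows "f (x - D *v v) + msqnorm D (g x) / 2 + c / 2 * msqnorm L (D *v v)
    \<le> f x + msqnorm D (v - g x) / 2"
proof -
  have sD: "symm D" using D by (rule psd_symm)
  have "f (x + - (D *v v)) \<le> f x + g x \<bullet> - (D *v v) + msqnorm L (- (D *v v)) / 2"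
    by (intro smooth_upper_bound has_derivative_f L_pd L_lip)
  moreover have "(c + 1) * msqnorm L (D *v v) \<le> msqnorm D v"
  proof -
    have "0 \<le> msqnorm (matrix_inv D - (c + 1) *\<^sub>R L) (D *v v)"
      using D_step by (intro msqnorm_nonneg) (simp add: loewner_ge_def c_def)
    also have "\<dots> = msqnorm (matrix_inv D) (D *v v) - (c + 1) * msqnorm L (D *v v)"
      by (simp add: msqnorm_def matrix_vector_mult_diff_rdistrib inner_diff_right
          flip: scaleR_matrix_vector_assoc)
    finally show ?thesis
      by (simp add: msqnorm_matrix_inv [OF sD pd_invertible [OF D_pd]])
  qed
  moreover have "msqnorm D (v - g x) = msqnorm D v - 2 * (g x \<bullet> (D *v v)) + msqnorm D (g x)"
    using msqnorm_add [OF sD, of v "- g x"] by (simp add: msqnorm_minus inner_commute)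
  ultimately show ?thesis
    by (simp add: msqnorm_minus algebra_simps)
qed

section \<open>The trajectory as iteration of a measurable transition map\<close>

definition step :: "(real^'d) \<times> (real^'d) \<Rightarrow> bool \<times> (nat \<Rightarrow> 'd mat) \<Rightarrow> (real^'d) \<times> (real^'d)" where
  "step s w = (let x = fst s; v = snd s; y = x - D *v v in
     (y, (1 / real n) *\<^sub>R (\<Sum>i<n. if fst w then G i y else v + snd w i *v (G i y - G i x))))"

text \<open>Unlike in \<open>marina\<close>, the initial gradient estimate is free, which the
  induction over iterations requires.\<close>

primrec run :: "(real^'d) \<times> (real^'d) \<Rightarrow> (nat \<Rightarrow> bool \<times> (nat \<Rightarrow> 'd mat)) \<Rightarrow> nat
    \<Rightarrow> (real^'d) \<times> (real^'d)" where
  "run s \<omega> 0 = s"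
| "run s \<omega> (Suc k) = step (run s \<omega> k) (\<omega> k)"

lemma marina_eq_run: "marina n G D x0 \<omega> k = run (x0, g x0) \<omega> k"
  by (induction k) (simp_all add: step_def Let_def split_beta)

text \<open>\<open>run\<close> appends steps at the end, while the product measure is split at its
  first coordinate; this moves the first step into the starting state.\<close>

lemma run_case_nat: "run s (case_nat w \<omega>) (Suc k) = run (step s w) \<omega> k"
  by (induction k) simp_all

definition step_space :: "(bool \<times> (nat \<Rightarrow> 'd mat)) measure" where
  "step_space = measure_pmf (bernoulli_pmf p) \<Otimes>\<^sub>M (\<Pi>\<^sub>M i\<in>{..<n}. S)"

lemma prob_space_sketches: "prob_space (\<Pi>\<^sub>M i\<in>{..<n}. S)"
  by (intro prob_space_PiM S.prob_space_axioms)

lemma prob_space_step: "prob_space step_space"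
  unfolding step_space_def
  by (intro prob_space_pair prob_space_sketches) (rule measure_pmf.prob_space_axioms)

lemma marina_space_eq: "marina_space n p S = (\<Pi>\<^sub>M k\<in>UNIV. step_space)"
  by (simp add: marina_space_def step_space_def)

lemma measurable_G: "i < n \<Longrightarrow> G i \<in> borel_measurable borel"
  by (intro borel_measurable_continuous_onI cont)

lemma measurable_g [measurable]: "g \<in> borel_measurable borel"
  unfolding avg_grad_def
  by (intro borel_measurable_scaleR borel_measurable_const borel_measurable_sum measurable_G) auto

lemma measurable_f [measurable]: "f \<in> borel_measurable borel"
  using has_derivative_f
  by (intro borel_measurable_continuous_onI continuous_at_imp_continuous_on ballI)
     (rule has_derivative_continuous)

lemma measurable_step [measurable]:
  "(\<lambda>(s, w). step s w) \<in> (borel \<Otimes>\<^sub>M borel) \<Otimes>\<^sub>M step_space \<rightarrow>\<^sub>M borel \<Otimes>\<^sub>M borel"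
proof -
  let ?M = "((borel :: (real^'d) measure) \<Otimes>\<^sub>M (borel :: (real^'d) measure)) \<Otimes>\<^sub>M step_space"
  have x [measurable]: "(\<lambda>z. fst (fst z)) \<in> ?M \<rightarrow>\<^sub>M borel"
    and v [measurable]: "(\<lambda>z. snd (fst z)) \<in> ?M \<rightarrow>\<^sub>M borel" by measurable
  have c [measurable]: "(\<lambda>z. fst (snd z)) \<in> ?M \<rightarrow>\<^sub>M count_space UNIV"
    unfolding step_space_def by measurable
  have y [measurable]: "(\<lambda>z. fst (fst z) - D *v snd (fst z)) \<in> ?M \<rightarrow>\<^sub>M borel"
    by measurable
  have "(\<lambda>z. if fst (snd z) then G i (fst (fst z) - D *v snd (fst z))
      else snd (fst z) + snd (snd z) i *v (G i (fst (fst z) - D *v snd (fst z)) - G i (fst (fst z))))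
    \<in> ?M \<rightarrow>\<^sub>M borel" if i: "i < n" for i
  proof -
    have [measurable]: "(\<lambda>z. G i (fst (fst z))) \<in> ?M \<rightarrow>\<^sub>M borel"
      by (rule measurable_compose [OF x measurable_G [OF i]])
    have [measurable]: "(\<lambda>z. G i (fst (fst z) - D *v snd (fst z))) \<in> ?M \<rightarrow>\<^sub>M borel"
      by (rule measurable_compose [OF y measurable_G [OF i]])
    have [measurable]: "(\<lambda>z. snd (snd z) i) \<in> ?M \<rightarrow>\<^sub>M borel"
    proof -
      have "i \<in> {..<n}" using i by simp
      then show ?thesis unfolding step_space_def by measurable
    qed
    show ?thesis by measurable
  qed
  then have "(\<lambda>z. (1 / real n) *\<^sub>R (\<Sum>i<n. if fst (snd z) then G i (fst (fst z) - D *v snd (fst z))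
      else snd (fst z) + snd (snd z) i *v (G i (fst (fst z) - D *v snd (fst z)) - G i (fst (fst z)))))
    \<in> ?M \<rightarrow>\<^sub>M borel"
    by (intro borel_measurable_scaleR borel_measurable_const borel_measurable_sum) auto
  then show ?thesis
    unfolding step_def Let_def split_beta by (intro measurable_Pair y)
qed

lemma measurable_run [measurable]: "(\<lambda>\<omega>. run s \<omega> k) \<in> (\<Pi>\<^sub>M k\<in>UNIV. step_space) \<rightarrow>\<^sub>M borel \<Otimes>\<^sub>M borel"
proof (induction k)
  case (Suc k)
  have "(\<lambda>\<omega>. (run s \<omega> k, \<omega> k)) \<in> (\<Pi>\<^sub>M k\<in>UNIV. step_space) \<rightarrow>\<^sub>M (borel \<Otimes>\<^sub>M borel) \<Otimes>\<^sub>M step_space"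
    using Suc by measurable
  from measurable_compose [OF this measurable_step] show ?case by simp
qed (simp add: space_pair_measure)

section \<open>Expected decrease of the potential\<close>

definition \<Phi> :: "(real^'d) \<times> (real^'d) \<Rightarrow> real" where
  "\<Phi> s = f (fst s) - fstar + msqnorm D (snd s - g (fst s)) / (2 * p)"

lemma measurable_Phi [measurable]: "\<Phi> \<in> borel_measurable (borel \<Otimes>\<^sub>M borel)"
  unfolding \<Phi>_def by measurable

text \<open>All workers share the estimate \<open>v\<close>, so it survives averaging; subtracting
  the new gradient centres each sketched difference, giving the shape handled by
  \<open>nn_integral_sketch_sum\<close>.\<close>

lemma snd_step_False:
  "snd (step (x, v) (False, T)) - g (fst (step (x, v) (False, T)))
    = (v - g x) + (1 / real n) *\<^sub>R (\<Sum>i<n. T i *v (G i (x - D *v v) - G i x) - (G i (x - D *v v) - G i x))"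
proof -
  have "(1 / real n) *\<^sub>R (\<Sum>i<n. v) = v" using n_pos by (simp only: sum_constant_scaleR) simp
  then show ?thesis
    by (simp add: step_def Let_def avg_grad_def sum.distrib sum_subtractf scaleR_add_right scaleR_diff_right)
qed

text \<open>The coin is integrated last: heads resets the error to zero, tails adds the sketch
  variance. The gradient term is added on the left because subtraction in \<open>ennreal\<close>
  truncates.\<close>

lemma nn_integral_Phi_step:
  "(\<integral>\<^sup>+w. ennreal (\<Phi> (step s w)) \<partial>step_space) + ennreal (msqnorm D (g (fst s)) / 2) \<le> ennreal (\<Phi> s)"
proof -
  obtain x v where s: "s = (x, v)" by (cases s)
  define y where "y = x - D *v v"
  \<comment> \<open>The next point \<open>y\<close> is independent of coin and sketches, so
    \<open>A\<close> is common to both branches; \<open>B\<close> is the expected squared error in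
    the sketched one.\<close>
  define A where "A = f y - fstar"
  define B where "B = msqnorm D (v - g x) + (1 / real n)\<^sup>2 * (\<Sum>i<n. msqnorm excess (G i y - G i x))"
  have A: "0 \<le> A" using lower [of y] by (simp add: A_def)
  have B: "0 \<le> B"
    unfolding B_def by (intro add_nonneg_nonneg mult_nonneg_nonneg sum_nonneg msqnorm_nonneg D psd_excess) simp
  interpret P: prob_space "\<Pi>\<^sub>M i\<in>{..<n}. S" by (rule prob_space_sketches)
  have fst_step: "fst (step s w) = y" for w
    by (simp add: s y_def step_def Let_def)
  have [measurable]: "(\<lambda>w. step s w) \<in> step_space \<rightarrow>\<^sub>M borel \<Otimes>\<^sub>M borel"
    using measurable_compose [OF measurable_Pair1' measurable_step, of s]
    by (simp add: space_pair_measure)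
  have m: "(\<lambda>w. ennreal (\<Phi> (step s w))) \<in> borel_measurable (measure_pmf (bernoulli_pmf p) \<Otimes>\<^sub>M (\<Pi>\<^sub>M i\<in>{..<n}. S))"
    unfolding step_space_def [symmetric] by measurable
  have "(\<integral>\<^sup>+w. ennreal (\<Phi> (step s w)) \<partial>step_space)
      = (\<integral>\<^sup>+c. \<integral>\<^sup>+T. ennreal (\<Phi> (step s (c, T))) \<partial>(\<Pi>\<^sub>M i\<in>{..<n}. S) \<partial>bernoulli_pmf p)"
    unfolding step_space_def by (rule P.nn_integral_fst [OF m, symmetric])
  also have "\<dots> = (\<integral>\<^sup>+T. ennreal (\<Phi> (step s (True, T))) \<partial>(\<Pi>\<^sub>M i\<in>{..<n}. S)) * ennreal p
      + (\<integral>\<^sup>+T. ennreal (\<Phi> (step s (False, T))) \<partial>(\<Pi>\<^sub>M i\<in>{..<n}. S)) * ennreal (1 - p)"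
    using p by simp
  also have "(\<integral>\<^sup>+T. ennreal (\<Phi> (step s (True, T))) \<partial>(\<Pi>\<^sub>M i\<in>{..<n}. S)) = ennreal A"
  proof -
    have "snd (step s (True, T)) = g y" for T
      by (simp add: s y_def step_def Let_def avg_grad_def)
    then have "\<Phi> (step s (True, T)) = A" for T
      by (simp add: \<Phi>_def fst_step A_def msqnorm_def)
    then show ?thesis by (simp add: P.emeasure_space_1)
  qed
  also have "(\<integral>\<^sup>+T. ennreal (\<Phi> (step s (False, T))) \<partial>(\<Pi>\<^sub>M i\<in>{..<n}. S)) = ennreal (A + B / (2 * p))"
  proof -
    let ?q = "\<lambda>T. msqnorm D ((v - g x) + (1 / real n) *\<^sub>R (\<Sum>i<n. T i *v (G i y - G i x) - (G i y - G i x)))"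
    have "ennreal (\<Phi> (step s (False, T))) = ennreal A + ennreal (1 / (2 * p)) * ennreal (?q T)" for T
    proof -
      have "\<Phi> (step s (False, T)) = A + 1 / (2 * p) * ?q T"
        using snd_step_False [of x v T] fst_step [of "(False, T)"]
        by (simp add: \<Phi>_def A_def s y_def)
      then show ?thesis
        using A p msqnorm_nonneg [OF D]
        by (simp add: ennreal_mult [symmetric] ennreal_plus [symmetric] del: ennreal_plus)
    qed
    then have "(\<integral>\<^sup>+T. ennreal (\<Phi> (step s (False, T))) \<partial>(\<Pi>\<^sub>M i\<in>{..<n}. S))
        = (\<integral>\<^sup>+T. ennreal A + ennreal (1 / (2 * p)) * ennreal (?q T) \<partial>(\<Pi>\<^sub>M i\<in>{..<n}. S))"
      by simp
    also have "\<dots> = ennreal A + ennreal (1 / (2 * p)) * (\<integral>\<^sup>+T. ennreal (?q T) \<partial>(\<Pi>\<^sub>M i\<in>{..<n}. S))"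
    proof -
      have q: "(\<lambda>T. ennreal (?q T)) \<in> borel_measurable (\<Pi>\<^sub>M i\<in>{..<n}. S)"
        by measurable
      show ?thesis
        by (subst nn_integral_add)
           (simp_all only: nn_integral_cmult [OF q] nn_integral_const P.emeasure_space_1 mult_1_right
             borel_measurable_const borel_measurable_times_ennreal q)
    qed
    also have "(\<integral>\<^sup>+T. ennreal (?q T) \<partial>(\<Pi>\<^sub>M i\<in>{..<n}. S)) = ennreal B"
      unfolding B_def by (rule nn_integral_sketch_sum) simp
    finally show ?thesis
      using A B p by (simp add: ennreal_mult [symmetric] ennreal_plus [symmetric] del: ennreal_plus)
  qed
  also have "ennreal A * ennreal p + ennreal (A + B / (2 * p)) * ennreal (1 - p)
      = ennreal (A + (1 - p) / (2 * p) * B)"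
  proof -
    have "A + (1 - p) / (2 * p) * B = A * p + (A + B / (2 * p)) * (1 - p)"
      using p by (simp add: field_simps)
    then show ?thesis
      using A B p by (simp only:) (simp add: ennreal_plus ennreal_mult del: times_divide_eq_right)
  qed
  finally have eq: "(\<integral>\<^sup>+w. ennreal (\<Phi> (step s w)) \<partial>step_space) = ennreal (A + (1 - p) / (2 * p) * B)" .
  have "A + (1 - p) / (2 * p) * B + msqnorm D (g x) / 2 \<le> \<Phi> s"
  proof -
    define e where "e = msqnorm D (v - g x)"
    have "y - x = - (D *v v)" by (simp add: y_def)
    then have "B \<le> e + R / real n * msqnorm L (D *v v)"
      using sum_excess_gradient_diff [of y x] by (simp add: B_def e_def msqnorm_minus)
    then have "(1 - p) / (2 * p) * B \<le> (1 - p) / (2 * p) * (e + R / real n * msqnorm L (D *v v))"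
      using p by (intro mult_left_mono) auto
    \<comment> \<open>The weight in \<open>\<Phi>\<close> is tuned to this identity:
      \<open>- e / 2\<close> cancels the error term of \<open>descent\<close>, and the last summand
      is exactly its surplus.\<close>
    also have "\<dots> = e / (2 * p) - e / 2 + (1 - p) * R / (real n * p) / 2 * msqnorm L (D *v v)"
      using p n_pos by (simp add: field_simps)
    finally show ?thesis
      using descent [of x v]
      unfolding \<Phi>_def s A_def fst_conv snd_conv y_def [symmetric] e_def [symmetric] by linarith
  qed
  then show ?thesis
    unfolding eq using A B p msqnorm_nonneg [OF D]
    by (simp add: s ennreal_plus [symmetric] ennreal_leI del: ennreal_plus)
qed

text \<open>Generalising over \<open>s\<close> lets the hypothesis apply to the random state after
  the first step, which replaces conditional expectations by iterated integrals. Keeping the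
  terminal potential in the integrand closes the induction.\<close>

lemma nn_integral_run:
  "(\<integral>\<^sup>+\<omega>. (\<Sum>j<k. ennreal (msqnorm D (g (fst (run s \<omega> j))) / 2)) + ennreal (\<Phi> (run s \<omega> k))
     \<partial>(\<Pi>\<^sub>M k\<in>UNIV. step_space)) \<le> ennreal (\<Phi> s)"
proof (induction k arbitrary: s)
  case 0
  interpret prob_space "\<Pi>\<^sub>M k\<in>(UNIV :: nat set). step_space"
    by (rule prob_space_PiM) (rule prob_space_step)
  show ?case by (simp add: emeasure_space_1)
next
  case (Suc k)
  let ?P = "\<Pi>\<^sub>M k\<in>(UNIV :: nat set). step_space"
  interpret P: prob_space ?P by (rule prob_space_PiM) (rule prob_space_step)
  interpret seq: sequence_space step_space
    using prob_space_step by (simp add: sequence_space_def product_prob_spaceI)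
  define h where "h x = ennreal (msqnorm D (g x) / 2)" for x
  have [measurable]: "h \<in> borel_measurable borel" unfolding h_def by measurable
  define F where "F k s \<omega> = (\<Sum>j<k. h (fst (run s \<omega> j))) + ennreal (\<Phi> (run s \<omega> k))" for k s \<omega>
  have F [measurable]: "F k s \<in> borel_measurable ?P" for k s
    unfolding F_def by measurable
  \<comment> \<open>The summand \<open>j = 0\<close> depends on the starting state alone, hence is
    constant under both integrals.\<close>
  have F_Suc: "F (Suc k) s (case_nat w \<omega>) = h (fst s) + F k (step s w) \<omega>" for w \<omega>
    unfolding F_def sum.lessThan_Suc_shift run_case_nat by (simp add: add.assoc)
  \<comment> \<open>The sequence space is the image of \<open>step_space\<close> times itself under
    prepending, so the integral transfers to the pair.\<close>
  have "(\<integral>\<^sup>+\<omega>. F (Suc k) s \<omega> \<partial>?P)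
      = (\<integral>\<^sup>+z. F (Suc k) s ((\<lambda>(w, \<omega>). case_nat w \<omega>) z) \<partial>(step_space \<Otimes>\<^sub>M ?P))"
    by (subst seq.PiM_iter [symmetric]) (rule nn_integral_distr; measurable)
  also have "\<dots> = (\<integral>\<^sup>+w. \<integral>\<^sup>+\<omega>. F (Suc k) s (case_nat w \<omega>) \<partial>?P \<partial>step_space)"
    using P.nn_integral_fst [of "\<lambda>z. F (Suc k) s ((\<lambda>(w, \<omega>). case_nat w \<omega>) z)" step_space]
    by simp
  also have "\<dots> = (\<integral>\<^sup>+w. h (fst s) + (\<integral>\<^sup>+\<omega>. F k (step s w) \<omega> \<partial>?P) \<partial>step_space)"
    unfolding F_Suc by (simp add: nn_integral_add P.emeasure_space_1)
  also have "\<dots> \<le> (\<integral>\<^sup>+w. h (fst s) + ennreal (\<Phi> (step s w)) \<partial>step_space)"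
    using Suc unfolding F_def h_def by (intro nn_integral_mono add_left_mono) blast
  also have "\<dots> = (\<integral>\<^sup>+w. ennreal (\<Phi> (step s w)) \<partial>step_space) + h (fst s)"
  proof -
    have [measurable]: "(\<lambda>w. step s w) \<in> step_space \<rightarrow>\<^sub>M borel \<Otimes>\<^sub>M borel"
      using measurable_compose [OF measurable_Pair1' measurable_step, of s]
      by (simp add: space_pair_measure)
    show ?thesis
      by (subst nn_integral_add) (simp_all add: prob_space.emeasure_space_1 [OF prob_space_step] add.commute)
  qed
  also have "\<dots> \<le> ennreal (\<Phi> s)"
    unfolding h_def by (rule nn_integral_Phi_step)
  finally show ?case unfolding F_def h_def .
qed

section \<open>Averaging over the iterates and the output index\<close>

lemma sum_nn_integral_gradient:
  "(\<Sum>k<K. \<integral>\<^sup>+\<omega>. ennreal (msqnorm D (g (fst (marina n G D x0 \<omega> k)))) \<partial>marina_space n p S)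
     \<le> ennreal (2 * (f x0 - fstar))"
proof -
  let ?P = "\<Pi>\<^sub>M k\<in>(UNIV :: nat set). step_space"
  let ?s = "(x0, g x0)"
  have "(\<Sum>k<K. \<integral>\<^sup>+\<omega>. ennreal (msqnorm D (g (fst (run ?s \<omega> k)))) \<partial>?P)
      = (\<integral>\<^sup>+\<omega>. (\<Sum>k<K. ennreal (msqnorm D (g (fst (run ?s \<omega> k))))) \<partial>?P)"
    by (subst nn_integral_sum) auto
  also have "\<dots> = (\<integral>\<^sup>+\<omega>. 2 * (\<Sum>k<K. ennreal (msqnorm D (g (fst (run ?s \<omega> k))) / 2)) \<partial>?P)"
    by (simp add: sum_distrib_left ennreal_mult' [symmetric] flip: ennreal_numeral)
  also have "\<dots> = 2 * (\<integral>\<^sup>+\<omega>. (\<Sum>k<K. ennreal (msqnorm D (g (fst (run ?s \<omega> k))) / 2)) \<partial>?P)"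
    by (rule nn_integral_cmult) measurable
  \<comment> \<open>Inserting the terminal potential can only enlarge the integral.\<close>
  also have "\<dots> \<le> 2 * (\<integral>\<^sup>+\<omega>. (\<Sum>k<K. ennreal (msqnorm D (g (fst (run ?s \<omega> k))) / 2))
      + ennreal (\<Phi> (run ?s \<omega> K)) \<partial>?P)"
    by (intro mult_left_mono nn_integral_mono) auto
  also have "\<dots> \<le> 2 * ennreal (\<Phi> ?s)"
    by (intro mult_left_mono nn_integral_run) auto
  \<comment> \<open>The initial estimate is the exact gradient, so the error part of
    \<open>\<Phi>\<close> vanishes.\<close>
  also have "\<dots> = ennreal (2 * (f x0 - fstar))"
    by (subst ennreal_mult') (simp_all add: \<Phi>_def msqnorm_def)
  finally show ?thesis
    unfolding marina_space_eq marina_eq_run .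
qed

text \<open>By Tonelli the uniform index becomes the outer integral, an average over
  \<open>k < K\<close>, to which the summed bound applies. The scalar \<open>a\<close> stands for
  the determinant factor.\<close>

lemma expected_gradient_bound:
  assumes K: "K \<ge> 1" and a: "a > 0"
  shows "(\<integral>\<^sup>+ (\<omega>, k). ennreal (msqnorm ((1 / a) *\<^sub>R D) (g (fst (marina n G D x0 \<omega> k))))
           \<partial>(marina_space n p S \<Otimes>\<^sub>M measure_pmf (pmf_of_set {..<K})))
         \<le> ennreal (2 * (f x0 - fstar) / (a * real K))"
proof -
  let ?P = "marina_space n p S" and ?U = "measure_pmf (pmf_of_set {..<K})"
  let ?q = "\<lambda>\<omega> k. ennreal (msqnorm D (g (fst (marina n G D x0 \<omega> k))))"
  have P: "prob_space ?P"
    unfolding marina_space_eq by (rule prob_space_PiM) (rule prob_space_step)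
  interpret pair_sigma_finite ?P ?U
    by (intro pair_sigma_finite.intro prob_space_imp_sigma_finite P measure_pmf.prob_space_axioms)
  have q: "(\<lambda>\<omega>. ?q \<omega> k) \<in> borel_measurable ?P" for k
    unfolding marina_space_eq marina_eq_run by measurable
  \<comment> \<open>The index takes countably many values, so measurability for each fixed
    \<open>k\<close> suffices for joint measurability.\<close>
  have "(\<lambda>z. ?q (fst z) (snd z)) \<in> borel_measurable (?P \<Otimes>\<^sub>M ?U)"
    by (rule measurable_compose_countable [where g = snd, OF measurable_compose [OF measurable_fst q]])
       measurable
  then have qm: "(\<lambda>(\<omega>, k). ennreal (1 / a) * ?q \<omega> k) \<in> borel_measurable (?P \<Otimes>\<^sub>M ?U)"
    unfolding split_beta by measurable
  have "(\<integral>\<^sup>+ (\<omega>, k). ennreal (msqnorm ((1 / a) *\<^sub>R D) (g (fst (marina n G D x0 \<omega> k)))) \<partial>(?P \<Otimes>\<^sub>M ?U))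
      = (\<integral>\<^sup>+ (\<omega>, k). ennreal (1 / a) * ?q \<omega> k \<partial>(?P \<Otimes>\<^sub>M ?U))"
    using a by (simp only: msqnorm_scaleR_mat)
      (simp add: ennreal_mult' [symmetric] del: times_divide_eq_left)
  also have "\<dots> = (\<integral>\<^sup>+k. \<integral>\<^sup>+\<omega>. ennreal (1 / a) * ?q \<omega> k \<partial>?P \<partial>?U)"
    using nn_integral_snd [OF qm] by simp
  also have "\<dots> = (\<integral>\<^sup>+k. ennreal (1 / a) * (\<integral>\<^sup>+\<omega>. ?q \<omega> k \<partial>?P) \<partial>?U)"
    by (simp add: nn_integral_cmult q)
  also have "\<dots> = ennreal (1 / a) * (\<integral>\<^sup>+k. (\<integral>\<^sup>+\<omega>. ?q \<omega> k \<partial>?P) \<partial>?U)"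
    by (rule nn_integral_cmult) simp
  also have "\<dots> = ennreal (1 / a) * ((\<Sum>k<K. \<integral>\<^sup>+\<omega>. ?q \<omega> k \<partial>?P) / ennreal (real K))"
    using K by (subst nn_integral_pmf_of_set) (auto simp: lessThan_empty_iff ennreal_of_nat_eq_real_of_nat)
  also have "\<dots> \<le> ennreal (1 / a) * (ennreal (2 * (f x0 - fstar)) / ennreal (real K))"
    by (intro mult_left_mono divide_right_mono_ennreal sum_nn_integral_gradient) simp
  also have "\<dots> = ennreal (2 * (f x0 - fstar) / (a * real K))"
    using K a lower [of x0] by (simp add: divide_ennreal ennreal_mult' [symmetric])
  finally show ?thesis .
qed

end

theorem theorem1:
  fixes fs :: "nat \<Rightarrow> real^'d::finite \<Rightarrow> real"
    and G :: "nat \<Rightarrow> real^'d \<Rightarrow> real^'d"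
    and n :: nat and fstar :: real
    and Ls :: "nat \<Rightarrow> real^'d^'d" and L D :: "real^'d^'d"
    and p :: real and S :: "(real^'d^'d) measure"
    and x0 :: "real^'d" and K :: nat
  assumes n_pos: "n \<ge> 1"
    and grad: "\<And>i x. i < n \<Longrightarrow> (fs i has_derivative (\<lambda>h. G i x \<bullet> h)) (at x)"
    and cont: "\<And>i. i < n \<Longrightarrow> continuous_on UNIV (G i)"
    and lower: "\<And>x. (1 / real n) * (\<Sum>i<n. fs i x) \<ge> fstar"
    and Ls_pd: "\<And>i. i < n \<Longrightarrow> pd (Ls i)"
    and L_pd: "pd L"
    and Li_lip: "\<And>i. i < n \<Longrightarrow> lipschitz_grad (Ls i) (G i)"
    and L_lip: "lipschitz_grad L (avg_grad n G)"
    and p: "0 < p" "p \<le> 1"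
    and S: "sketch_distr S"
    and D_pd: "pd D"
    and D_step: "loewner_ge (matrix_inv D)
                   (((1 - p) * R_const n Ls L D S / (real n * p) + 1) *\<^sub>R L)"
    and K: "K \<ge> 1"
  shows "(\<integral>\<^sup>+ (\<omega>, k). ennreal (msqnorm ((1 / det D powr (1 / real CARD('d))) *\<^sub>R D)
               (avg_grad n G (fst (marina n G D x0 \<omega> k))))
           \<partial>(marina_space n p S \<Otimes>\<^sub>M measure_pmf (pmf_of_set {..<K})))
         \<le> ennreal (2 * ((1 / real n) * (\<Sum>i<n. fs i x0) - fstar)
                    / (det D powr (1 / real CARD('d)) * real K))"
proof -
  interpret det_marina S D fs G n fstar Ls L p
    using assms by unfold_locales (simp_all add: pd_imp_psd)
  show ?thesis
    using K pd_det_pos [OF D_pd] by (intro expected_gradient_bound) simp_all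
qed

end
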